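(* Let $f:X\to Y$ be a Lipschitz map from a geodesic metric space $X$ to a metric space $Y$, and let $n$ be a non-negative integer. Suppose that for every $R>0$ the family $\{f^{-1}(B_R(y))\}_{y\in Y}$ of subsets of $X$ satisfies the inequality $\operatorname{asdim}\le n$ uniformly. Then $\operatorname{asdim} X\le \operatorname{asdim} Y+n$.
   Context: For a metric space $X$, $\operatorname{asdim} X\le n$ means: for every $D>0$ there exist families $\mathcal{U}_0,\ldots,\mathcal{U}_n$ of uniformly bounded subsets of $X$, each family $D$-disjoint, whose union covers $X$. A family $\mathcal{U}$ is $D$-disjoint if $d(U,V)>D$ for all $U\ne V$ in $\mathcal{U}$, where $d(U,V)=\inf\{d(u,v): u\in U, v\in V\}$. $\operatorname{asdim}X$ is the smallest such integer $n$ ($\infty$ if none exists). A family $\{X_\alpha\}$ of subsets of a metric space satisfies $\operatorname{asdim} X_\alpha\le n$ uniformly if for every sufficiently large $D>0$ there is an $R>0$ such that for each $\alpha$ there exist $R$-bounded (all members have diameter at most $R$), $D$-disjoint families $\mathcal{U}^0_\alpha,\ldots,\mathcal{U}^n_\alpha$ with $\bigcup_{i=0}^n\mathcal{U}^i_\alpha$ a cover of $X_\alpha$ (the same $R$ for all $\alpha$). $B_R(y)$ denotes the ball of radius $R$ about $y$. *)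

theory Defs
  imports "HOL-Analysis.Analysis"
begin

(* A metric space is represented by a subset X of a metric_space type, with the metric dist
   restricted to X; X = UNIV gives the type itself. *)

definition geodesic_space :: "'a::metric_space set \<Rightarrow> bool" where
  "geodesic_space X \<longleftrightarrow>
     (\<forall>x\<in>X. \<forall>y\<in>X. \<exists>g :: real \<Rightarrow> 'a.
        g \<in> {0..dist x y} \<rightarrow> X \<and> g 0 = x \<and> g (dist x y) = y \<and>
        (\<forall>s\<in>{0..dist x y}. \<forall>t\<in>{0..dist x y}. dist (g s) (g t) = \<bar>s - t\<bar>))"

(* The library sets setdist to 0 if one of its arguments is empty, whereas the infimum of the
   empty set of distances is infinite, so that an empty member is D-disjoint from every other
   one; hence the two nonemptiness guards. *)
definition D_disjoint :: "real \<Rightarrow> 'a::metric_space set set \<Rightarrow> bool" where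
  "D_disjoint D \<U> \<longleftrightarrow>
     (\<forall>U\<in>\<U>. \<forall>V\<in>\<U>. U \<noteq> V \<longrightarrow> U \<noteq> {} \<longrightarrow> V \<noteq> {} \<longrightarrow> setdist U V > D)"

(* The conjunct bounded U is needed: the supremum in diameter U is unspecified otherwise. *)
definition R_bounded :: "real \<Rightarrow> 'a::metric_space set set \<Rightarrow> bool" where
  "R_bounded R \<U> \<longleftrightarrow> (\<forall>U\<in>\<U>. bounded U \<and> diameter U \<le> R)"

definition asdim_le :: "'a::metric_space set \<Rightarrow> nat \<Rightarrow> bool" where
  "asdim_le X n \<longleftrightarrow>
     (\<forall>D>0. \<exists>\<U> :: nat \<Rightarrow> 'a set set.
        (\<forall>i\<le>n. \<U> i \<subseteq> Pow X \<and> (\<exists>R. R_bounded R (\<U> i)) \<and> D_disjoint D (\<U> i)) \<and>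
        X \<subseteq> (\<Union>i\<le>n. \<Union>(\<U> i)))"

(* The infimum of the empty set in enat is infinity. *)
definition asdim :: "'a::metric_space set \<Rightarrow> enat" where
  "asdim X = Inf {enat n | n. asdim_le X n}"

(* The members of the covering families need not lie in S a; replacing each of them by its
   intersection with S a keeps them R-bounded and D-disjoint, so this makes no difference. *)
definition asdim_le_uniformly :: "'i set \<Rightarrow> ('i \<Rightarrow> 'a::metric_space set) \<Rightarrow> nat \<Rightarrow> bool" where
  "asdim_le_uniformly A S n \<longleftrightarrow>
     (\<forall>\<^sub>F D in at_top. \<exists>R>0. \<forall>a\<in>A. \<exists>\<U> :: nat \<Rightarrow> 'a set set.
        (\<forall>i\<le>n. R_bounded R (\<U> i) \<and> D_disjoint D (\<U> i)) \<and>
        S a \<subseteq> (\<Union>i\<le>n. \<Union>(\<U> i)))"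

end

(* The Kolmogorov trick turns a cover of an n-dimensional set into k > n coloured pieces such that
   every point misses at most n colours, the pieces still having uniformly bounded components at a
   prescribed scale. Let m = asdim Y and k = m + n + 1, let r be the scale wanted on X and L a
   Lipschitz constant of f. Colour Y with k colours at scale L r, every point having at least n +
   1 colours and components having diameter at most S; then cover Y by m + 1 families of bounded,
   S-disjoint sets Z, and colour the preimage of each Z with k colours, every point having at
   least m + 1 colours, where the scale used for the l-th family grows fast with l. As (n + 1) +
   (m + 1) > k, every point of X has a colour in common with its image. A component of the set of
   points with common colour i maps to a set of diameter at most S, hence meets only one Z of each
   family, and the rapidly growing scales allow the m + 1 pieces to be glued with control on the
   diameter. *)
theory Submission
  imports Defs
begin

section \<open>Components at a given scale\<close>

text \<open>On \<open>A\<close> this is an equivalence relation whose classes are the components of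
  \<open>A\<close> at scale \<open>r\<close>. A whole disjoint family is thereby encoded by its
  union, the members being recovered as components.\<close>

definition chain :: "real \<Rightarrow> 'a::metric_space set \<Rightarrow> 'a \<Rightarrow> 'a \<Rightarrow> bool" where
  "chain r A = (\<lambda>x y. x \<in> A \<and> y \<in> A \<and> dist x y \<le> r)\<^sup>*\<^sup>*"

(* As chain r A x x holds even for x outside A, this forces R to be nonnegative. *)
definition scale_bounded :: "real \<Rightarrow> real \<Rightarrow> 'a::metric_space set \<Rightarrow> bool" where
  "scale_bounded r R A \<longleftrightarrow> (\<forall>x y. chain r A x y \<longrightarrow> dist x y \<le> R)"

lemma chain_refl [simp, intro]: "chain r A x x"
  by (simp add: chain_def)

lemma chain_step:
  "chain r A x y \<Longrightarrow> y \<in> A \<Longrightarrow> z \<in> A \<Longrightarrow> dist y z \<le> r \<Longrightarrow> chain r A x z"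
  unfolding chain_def by (rule rtranclp.rtrancl_into_rtrancl) auto

lemma chain_induct [consumes 1, case_names refl step]:
  assumes "chain r A x y"
    and "P x"
    and "\<And>y z. chain r A x y \<Longrightarrow> P y \<Longrightarrow> y \<in> A \<Longrightarrow> z \<in> A \<Longrightarrow> dist y z \<le> r \<Longrightarrow> P z"
  shows "P y"
  using assms(1) unfolding chain_def
  by (induction rule: rtranclp_induct) (use assms(2,3) in \<open>auto simp: chain_def\<close>)

lemma chain_trans: "chain r A x y \<Longrightarrow> chain r A y z \<Longrightarrow> chain r A x z"
  unfolding chain_def by (rule rtranclp_trans)

lemma chain_sym: "chain r A x y \<Longrightarrow> chain r A y x"
  unfolding chain_def
  by (rule sympD[OF symp_rtranclp]) (auto simp: symp_def dist_commute)

lemma chain_mono: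
  assumes "chain r A x y" "r \<le> s" "A \<subseteq> B"
  shows "chain s B x y"
  using assms(1) by (induction rule: chain_induct) (use assms(2,3) in \<open>auto intro: chain_step\<close>)

lemma scale_boundedD: "scale_bounded r R A \<Longrightarrow> chain r A x y \<Longrightarrow> dist x y \<le> R"
  by (auto simp: scale_bounded_def)

lemma scale_bounded_nonneg: "scale_bounded r R A \<Longrightarrow> 0 \<le> R"
  by (metis chain_refl dist_self scale_boundedD)

lemma scale_bounded_mono:
  "scale_bounded s R B \<Longrightarrow> r \<le> s \<Longrightarrow> R \<le> R' \<Longrightarrow> A \<subseteq> B \<Longrightarrow> scale_bounded r R' A"
  unfolding scale_bounded_def by (meson chain_mono order_trans)

text \<open>A step of length at most \<open>D\<close> cannot pass between two distinct members, so a
  chain never leaves the member in which it starts.\<close>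

lemma scale_bounded_Union:
  assumes "D_disjoint D \<U>" "R_bounded R \<U>" "0 \<le> R"
  shows "scale_bounded D R (\<Union>\<U>)"
  unfolding scale_bounded_def
proof (intro allI impI)
  fix x y assume ch: "chain D (\<Union>\<U>) x y"
  have stay: "y \<in> U" if "U \<in> \<U>" "x \<in> U" for U
    using ch
  proof (induction rule: chain_induct)
    case refl
    show ?case by fact
  next
    case (step y z)
    then obtain V where V: "V \<in> \<U>" "z \<in> V" by blast
    have "setdist U V \<le> D"
      using setdist_le_dist[OF step.IH V(2)] step.hyps by linarith
    then show ?case
      using assms(1) that V step.IH unfolding D_disjoint_def by fastforce
  qed
  show "dist x y \<le> R"
  proof (cases "x \<in> \<Union>\<U>")
    case True
    then obtain U where U: "U \<in> \<U>" "x \<in> U" by blast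
    then have "dist x y \<le> diameter U"
      using assms(2) stay by (intro diameter_bounded_bound) (auto simp: R_bounded_def)
    then show ?thesis
      using assms(2) U unfolding R_bounded_def by fastforce
  next
    case False
    have "x = y"
      using ch by (induction rule: chain_induct) (use False in auto)
    then show ?thesis using assms(3) by simp
  qed
qed

text \<open>Converse passage from a set to a family: the components at scale \<open>r\<close> serve
  as members. The infimum of distances between two components is only known to be at least
  \<open>r\<close>; the gap \<open>D < r\<close> restores the strict inequality of
  \<open>D_disjoint\<close>.\<close>

lemma scale_bounded_components:
  assumes "scale_bounded r R A" "D < r"
  obtains \<U> where "\<U> \<subseteq> Pow A" "R_bounded R \<U>" "D_disjoint D \<U>" "\<Union>\<U> = A"
proof
  let ?C = "\<lambda>x. {y \<in> A. chain r A x y}"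
  let ?U = "?C ` A"
  have R: "0 \<le> R"
    using assms(1) by (rule scale_bounded_nonneg)
  show "?U \<subseteq> Pow A" "\<Union>?U = A" by auto
  have close: "dist y z \<le> R" if "y \<in> ?C x" "z \<in> ?C x" for x y z
    using that assms(1) chain_sym chain_trans scale_boundedD by (metis (mono_tags, lifting) mem_Collect_eq)
  have "bounded (?C x)" for x
    unfolding bounded_def
    by (rule exI[of _ x], rule exI[of _ R]) (use assms(1) scale_boundedD in auto)
  moreover have "diameter (?C x) \<le> R" for x
    unfolding diameter_def using R close[of _ x] by (auto intro!: cSUP_least)
  ultimately show "R_bounded R ?U"
    by (auto simp: R_bounded_def)
  show "D_disjoint D ?U"
    unfolding D_disjoint_def
  proof (intro ballI impI)
    fix U V assume UV: "U \<in> ?U" "V \<in> ?U" "U \<noteq> V" "U \<noteq> {}" "V \<noteq> {}"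
    then obtain a b where ab: "U = ?C a" "V = ?C b" "a \<in> A" "b \<in> A" by auto
    have "r \<le> dist u v" if uv: "u \<in> U" "v \<in> V" for u v
    proof (rule ccontr)
      assume "\<not> r \<le> dist u v"
      then have "chain r A a v"
        using uv ab by (auto intro: chain_step)
      then have "chain r A a b"
        using uv ab chain_sym chain_trans by blast
      then have "?C a = ?C b"
        using chain_sym chain_trans by blast
      then show False using UV ab by simp
    qed
    then have "r \<le> setdist U V"
      using UV by (intro le_setdistI) auto
    then show "D < setdist U V" using assms(2) by simp
  qed
qed

(* Saturated union: a component of A of diameter at most P is close to at most one component
   of B at scale s. *)
lemma scale_bounded_Un:
  assumes A: "scale_bounded r P A" and B: "scale_bounded s Q B"
    and s: "P + 2 * r \<le> s" and r: "0 \<le> r"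
  shows "scale_bounded r (Q + 2 * P + 2 * r) (A \<union> B)"
  unfolding scale_bounded_def
proof (intro allI impI)
  fix x y assume ch: "chain r (A \<union> B) x y"
  have P: "0 \<le> P" and Q: "0 \<le> Q"
    using A B by (auto dest: scale_bounded_nonneg)
  \<comment> \<open>\<open>near b y\<close>: the chain has left \<open>b\<close> for an excursion
    through a single component of \<open>A\<close> that starts within \<open>r\<close> of
    \<open>b\<close>, hence stays within \<open>r + P\<close> of \<open>b\<close>.\<close>
  define near where "near = (\<lambda>b y. y = b \<or> (\<exists>a\<in>A. dist b a \<le> r \<and> chain r A a y))"
  have near_dist: "dist b y \<le> r + P" if "near b y" for b y
    using that unfolding near_def
  proof
    assume "\<exists>a\<in>A. dist b a \<le> r \<and> chain r A a y"
    then obtain a where "dist b a \<le> r" "dist a y \<le> P"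
      using scale_boundedD[OF A] by blast
    then show ?thesis using dist_triangle[of b y a] by linarith
  qed (use P r in simp)
  \<comment> \<open>Invariant: either only a component of \<open>A\<close> has been visited, or
    \<open>B\<close> was entered at \<open>b\<close> and the chain is now near \<open>b'\<close>. An
    excursion from \<open>b'\<close> back to \<open>B\<close> ends within
    \<open>(r + P) + r \<le> s\<close> of \<open>b'\<close>, so it counts as one step at scale
    \<open>s\<close>. Getting to \<open>b\<close> and away from \<open>b'\<close> costs
    \<open>r + P\<close> each, on top of \<open>Q\<close>.\<close>
  have "chain r A x y \<or> (\<exists>b b'. b' \<in> B \<and> dist x b \<le> r + P \<and> chain s B b b' \<and> near b' y)"
    using ch
  proof (induction rule: chain_induct)
    case refl
    show ?case by simp
  next
    case (step y z)
    from step.IH show ?case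
    proof (elim disjE exE conjE)
      assume xy: "chain r A x y"
      show ?thesis
      proof (cases "z \<in> B")
        case True
        have "dist x z \<le> r + P"
          using scale_boundedD[OF A xy] dist_triangle[of x z y] step.hyps by linarith
        then show ?thesis using True by (auto simp: near_def)
      next
        case False
        then have z: "z \<in> A" using step.hyps by simp
        show ?thesis
        proof (cases "y \<in> A")
          case True
          then show ?thesis using xy z step.hyps by (auto intro: chain_step)
        next
          case False
          then have "y \<in> B" using step.hyps by simp
          moreover have "dist x y \<le> r + P"
            using scale_boundedD[OF A xy] r by linarith
          moreover have "near y z"
            using z step.hyps by (auto simp: near_def)
          ultimately show ?thesis by blast
        qed
      qed
    next
      fix b b' assume b: "b' \<in> B" "dist x b \<le> r + P" "chain s B b b'" "near b' y"
      show ?thesis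
      proof (cases "z \<in> B")
        case True
        have "dist b' z \<le> s"
          using near_dist[OF b(4)] dist_triangle[of b' z y] step.hyps s by linarith
        then have "chain s B b z"
          using b True by (auto intro: chain_step)
        then show ?thesis using b True by (auto simp: near_def)
      next
        case False
        then have z: "z \<in> A" using step.hyps by simp
        \<comment> \<open>For \<open>y\<close> in \<open>A\<close> the excursion from
          \<open>b'\<close> goes on or begins; otherwise \<open>y\<close> lies in \<open>B\<close>
          and replaces \<open>b'\<close>.\<close>
        from b(4) have "near b' z \<or> (near y z \<and> y \<in> B \<and> chain s B b y)"
        proof (cases "y \<in> A")
          case True
          show ?thesis
          proof (cases "y = b'")
            case True
            then show ?thesis using z step.hyps by (auto simp: near_def)
          next
            case False
            then obtain a where a: "a \<in> A" "dist b' a \<le> r" "chain r A a y"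
              using b(4) by (auto simp: near_def)
            then have "chain r A a z"
              using \<open>y \<in> A\<close> z step.hyps by (auto intro: chain_step)
            then show ?thesis using a by (auto simp: near_def)
          qed
        next
          case False
          then have y: "y \<in> B" using step.hyps by simp
          have "dist b' y \<le> s"
            using near_dist[OF b(4)] s r by linarith
          then have "chain s B b y"
            using b y by (auto intro: chain_step)
          then show ?thesis
            using y z step.hyps by (auto simp: near_def)
        qed
        then show ?thesis using b by blast
      qed
    qed
  qed
  then show "dist x y \<le> Q + 2 * P + 2 * r"
  proof (elim disjE exE conjE)
    assume "chain r A x y"
    from scale_boundedD[OF A this] show ?thesis using P Q r by linarith
  next
    fix b b' assume b: "dist x b \<le> r + P" "chain s B b b'" "near b' y"
    show ?thesis
      using scale_boundedD[OF B b(2)] near_dist[OF b(3)] b(1)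
        dist_triangle[of x y b] dist_triangle[of b y b'] by linarith
  qed
qed

text \<open>Here \<open>\<rho> s\<close> is the bound on components available at scale
  \<open>s\<close>. The recursion iterates \<open>scale_bounded_Un\<close> with \<open>P\<close> the
  bound for the pieces glued so far and \<open>Q\<close> the bound for the new piece.\<close>

primrec glued_bound :: "(real \<Rightarrow> real) \<Rightarrow> real \<Rightarrow> nat \<Rightarrow> real" where
  "glued_bound \<rho> r 0 = \<rho> r"
| "glued_bound \<rho> r (Suc l) =
     \<rho> (glued_bound \<rho> r l + 2 * r) + 2 * glued_bound \<rho> r l + 2 * r"

text \<open>The scale demanded of piece \<open>l\<close>: the least value of \<open>s\<close> that
  \<open>scale_bounded_Un\<close> admits for gluing it to the earlier pieces.\<close>

primrec glued_scale :: "(real \<Rightarrow> real) \<Rightarrow> real \<Rightarrow> nat \<Rightarrow> real" where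
  "glued_scale \<rho> r 0 = r"
| "glued_scale \<rho> r (Suc l) = glued_bound \<rho> r l + 2 * r"

lemma glued_scale_nonneg:
  assumes "\<And>s. 0 \<le> s \<Longrightarrow> 0 \<le> \<rho> s" "0 \<le> r"
  shows "0 \<le> glued_scale \<rho> r l"
proof -
  have "0 \<le> glued_bound \<rho> r l" for l
    by (induction l) (use assms in auto)
  then show ?thesis using assms(2) by (cases l) auto
qed

lemma scale_bounded_UN:
  assumes "\<And>l. l \<le> m \<Longrightarrow> scale_bounded (glued_scale \<rho> r l) (\<rho> (glued_scale \<rho> r l)) (A l)"
    and "0 \<le> r"
  shows "scale_bounded r (glued_bound \<rho> r m) (\<Union>l\<le>m. A l)"
  using assms(1)
proof (induction m)
  case 0
  from 0[of 0] show ?case by simp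
next
  case (Suc m)
  have "scale_bounded r (glued_bound \<rho> r m) (\<Union>l\<le>m. A l)"
    using Suc by simp
  from scale_bounded_Un[OF this Suc.prems[of "Suc m"]] assms(2) show ?case
    by (simp add: atMost_Suc Un_commute)
qed

section \<open>The Kolmogorov trick\<close>

text \<open>The count is additive to avoid truncated subtraction: a point may miss at most
  \<open>n\<close> of the \<open>k\<close> colours. For \<open>k = Suc n\<close> this is ordinary
  covering; larger \<open>k\<close> adds redundancy. The sets \<open>A i\<close> may reach outside
  \<open>S\<close>.\<close>

definition multi_cover ::
    "'a::metric_space set \<Rightarrow> nat \<Rightarrow> nat \<Rightarrow> real \<Rightarrow> real \<Rightarrow> (nat \<Rightarrow> 'a set) \<Rightarrow> bool" where
  "multi_cover S n k r R A \<longleftrightarrow>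
     (\<forall>i<k. scale_bounded r R (A i)) \<and> (\<forall>x\<in>S. k \<le> n + card {i. i < k \<and> x \<in> A i})"

lemma multi_cover_mono:
  assumes "multi_cover S n k s R A" "r \<le> s" "R \<le> R'" "T \<subseteq> S"
  shows "multi_cover T n k r R' A"
  unfolding multi_cover_def
proof (intro conjI allI impI ballI)
  fix i assume "i < k"
  then have "scale_bounded s R (A i)"
    using assms(1) by (simp add: multi_cover_def)
  then show "scale_bounded r R' (A i)"
    using assms(2,3) by (rule scale_bounded_mono) simp
next
  fix x assume "x \<in> T"
  then show "k \<le> n + card {i. i < k \<and> x \<in> A i}"
    using assms(1,4) by (auto simp: multi_cover_def)
qed

text \<open>Moving each point of a chain to a point of \<open>A\<close> within \<open>r\<close>
  turns steps of length \<open>r\<close> into steps of length \<open>3 * r\<close>; moving the two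
  endpoints back costs \<open>2 * r\<close>.\<close>

lemma scale_bounded_nbhd:
  assumes "scale_bounded (3 * r) R A" "0 \<le> r"
  shows "scale_bounded r (R + 2 * r) {y. \<exists>x\<in>A. dist x y \<le> r}" (is "scale_bounded _ _ ?N")
  unfolding scale_bounded_def
proof (intro allI impI)
  fix x y assume ch: "chain r ?N x y"
  have R: "0 \<le> R" using assms(1) by (rule scale_bounded_nonneg)
  show "dist x y \<le> R + 2 * r"
  proof (cases "x \<in> ?N")
    case True
    then obtain x' where x': "x' \<in> A" "dist x' x \<le> r" by blast
    have "\<exists>y'\<in>A. dist y' y \<le> r \<and> chain (3 * r) A x' y'"
      using ch
    proof (induction rule: chain_induct)
      case refl
      then show ?case using x' by blast
    next
      case (step y z)
      then obtain y' z' where y': "y' \<in> A" "dist y' y \<le> r" "chain (3 * r) A x' y'"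
        and z': "z' \<in> A" "dist z' z \<le> r" by blast
      have "dist y' z' \<le> 3 * r"
        using y'(2) z'(2) step.hyps dist_triangle[of y' z' y] dist_triangle[of y z' z]
        by (simp add: dist_commute)
      then show ?case using y' z' chain_step by blast
    qed
    then obtain y' where "dist y' y \<le> r" "chain (3 * r) A x' y'" by blast
    then show ?thesis
      using x'(2) scale_boundedD[OF assms(1), of x' y']
        dist_triangle[of x y x'] dist_triangle[of x' y y']
      by (simp add: dist_commute)
  next
    case False
    have "x = y"
      using ch by (induction rule: chain_induct) (use False in auto)
    then show ?thesis using R assms(2) by simp
  qed
qed

(* The new colour is given to the points that have at most k - n colours after the colours have
   been thickened; the set of colours is then constant along chains of such points. *)
lemma Kolmogorov_step:
  assumes cov: "multi_cover S n k (3 * r) R A" and "n < k" and r: "0 \<le> r"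
  shows "\<exists>A'. multi_cover S n (Suc k) r (R + 2 * r) A'"
proof -
  define N where "N i = {y. \<exists>x\<in>A i. dist x y \<le> r}" for i
  define I where "I x = {i. i < k \<and> x \<in> A i}" for x
  define J where "J x = {i. i < k \<and> x \<in> N i}" for x
  define E where "E = {x\<in>S. n + card (J x) \<le> k}"
  define A' where "A' i = (if i = k then E else N i)" for i
  have fin: "finite (I x)" "finite (J x)" for x
    by (auto simp: I_def J_def)
  have IJ: "I x \<subseteq> J y" if "dist x y \<le> r" for x y
    using that by (auto simp: I_def J_def N_def)
  have I_card: "k \<le> n + card (I x)" if "x \<in> S" for x
    using cov that by (auto simp: multi_cover_def I_def)
  \<comment> \<open>The inclusion \<open>I x \<subseteq> J y\<close> is squeezed to equality: in
    \<open>E\<close> the thickened colours number at most \<open>k - n\<close>, and the original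
    ones at least that many.\<close>
  have I_eq: "I x = J y" if "x \<in> E" "y \<in> E" "dist x y \<le> r" for x y
    by (rule card_seteq[OF fin(2) IJ[OF that(3)]])
       (use that I_card[of x] in \<open>auto simp: E_def\<close>)
  have R: "0 \<le> R"
    using cov \<open>n < k\<close> scale_bounded_nonneg unfolding multi_cover_def by blast
  have "scale_bounded r (R + 2 * r) E"
    unfolding scale_bounded_def
  proof (intro allI impI)
    fix x y assume ch: "chain r E x y"
    show "dist x y \<le> R + 2 * r"
    proof (cases "x \<in> E")
      case True
      \<comment> \<open>Since \<open>n < k\<close>, some original colour \<open>i\<close> is present
        at \<open>x\<close>. It persists along the chain, which therefore runs inside
        \<open>A i\<close>.\<close>
      have "0 < card (I x)"
        using True I_card[of x] \<open>n < k\<close> by (auto simp: E_def)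
      then obtain i where i: "i \<in> I x"
        by (metis card_gt_0_iff ex_in_conv)
      have "i \<in> I y \<and> chain (3 * r) (A i) x y"
        using ch
      proof (induction rule: chain_induct)
        case refl
        show ?case using i by simp
      next
        case (step y z)
        then have "I y = I z"
          using I_eq[of y z] I_eq[of z z] r by simp
        then have "i \<in> I z" "y \<in> A i" "z \<in> A i"
          using step.IH by (auto simp: I_def)
        moreover have "dist y z \<le> 3 * r"
          using step.hyps r by linarith
        ultimately show ?case using step.IH chain_step by blast
      qed
      then have "dist x y \<le> R"
        using cov i by (auto simp: multi_cover_def I_def dest: scale_boundedD)
      then show ?thesis using r by simp
    next
      case False
      have "x = y"
        using ch by (induction rule: chain_induct) (use False in auto)
      then show ?thesis using R r by simp
    qed
  qed
  moreover have "scale_bounded r (R + 2 * r) (N i)" if "i < k" for i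
    unfolding N_def using cov that r by (intro scale_bounded_nbhd) (auto simp: multi_cover_def)
  \<comment> \<open>Points of \<open>E\<close> gain the new colour \<open>k\<close>; points of
    \<open>S\<close> outside \<open>E\<close> already have more than \<open>k - n\<close> thickened
    colours.\<close>
  moreover have "Suc k \<le> n + card {i. i < Suc k \<and> x \<in> A' i}" if x: "x \<in> S" for x
  proof (cases "x \<in> E")
    case True
    then have "{i. i < Suc k \<and> x \<in> A' i} = insert k (J x)"
      by (auto simp: A'_def J_def less_Suc_eq)
    moreover have "k \<notin> J x" by (simp add: J_def)
    moreover have "card (I x) \<le> card (J x)"
      using fin IJ[of x x] r by (intro card_mono) auto
    ultimately show ?thesis
      using I_card[OF x] fin by simp
  next
    case False
    then have "{i. i < Suc k \<and> x \<in> A' i} = J x"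
      by (auto simp: A'_def J_def less_Suc_eq)
    then show ?thesis using False x by (auto simp: E_def)
  qed
  ultimately have "multi_cover S n (Suc k) r (R + 2 * r) A'"
    by (auto simp: multi_cover_def A'_def less_Suc_eq)
  then show ?thesis by blast
qed

text \<open>Each added colour divides the scale by 3 and raises the bound by twice the new scale.
  The increments \<open>2 * r * (1 + 3 + ... + 3 ^ (j - 1))\<close> sum to
  \<open>3 ^ j * r - r\<close>.\<close>

lemma Kolmogorov_trick:
  assumes "multi_cover S n (Suc n) (3 ^ j * r) R A" "0 \<le> r"
  shows "\<exists>A'. multi_cover S n (Suc n + j) r (R + 3 ^ j * r - r) A'"
  using assms
proof (induction j arbitrary: r)
  case 0
  then show ?case by auto
next
  case (Suc j)
  then obtain A' where A': "multi_cover S n (Suc n + j) (3 * r) (R + 3 ^ j * (3 * r) - 3 * r) A'"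
    using Suc.IH[of "3 * r"] by (auto simp: mult_ac)
  from Kolmogorov_step[OF this] Suc.prems(2) show ?case
    by (simp add: mult_ac)
qed

section \<open>From covering families to coloured covers\<close>

lemma multi_cover_families:
  assumes "\<forall>i\<le>n. R_bounded R (\<U> i) \<and> D_disjoint D (\<U> i)" "0 \<le> R"
    and "S \<subseteq> (\<Union>i\<le>n. \<Union>(\<U> i))"
  shows "multi_cover S n (Suc n) D R (\<lambda>i. \<Union>(\<U> i))"
  unfolding multi_cover_def
proof (intro conjI allI impI ballI)
  fix i assume "i < Suc n"
  then show "scale_bounded D R (\<Union>(\<U> i))"
    using assms by (intro scale_bounded_Union) auto
next
  fix x assume "x \<in> S"
  then have "x \<in> (\<Union>i\<le>n. \<Union>(\<U> i))"
    using assms(3) by (rule subsetD[rotated])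
  then obtain i where "i \<le> n" "x \<in> \<Union>(\<U> i)"
    by auto
  then have "i \<in> {i. i < Suc n \<and> x \<in> \<Union>(\<U> i)}"
    by auto
  then have "{i. i < Suc n \<and> x \<in> \<Union>(\<U> i)} \<noteq> {}"
    by blast
  then have "0 < card {i. i < Suc n \<and> x \<in> \<Union>(\<U> i)}"
    by (subst card_gt_0_iff) auto
  then show "Suc n \<le> n + card {i. i < Suc n \<and> x \<in> \<Union>(\<U> i)}"
    by simp
qed

text \<open>The bound produced by the Kolmogorov trick depends only on \<open>R\<close>,
  \<open>j\<close> and \<open>r\<close>, so uniformity over the index set survives.\<close>

lemma asdim_le_uniformly_multi_cover:
  fixes S :: "'i \<Rightarrow> 'b::metric_space set"
  assumes "asdim_le_uniformly I S n" "0 \<le> r"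
  shows "\<exists>R\<ge>0. \<forall>a\<in>I. \<exists>A. multi_cover (S a) n (Suc n + j) r R A"
proof -
  obtain D0 where D0: "\<And>D. D0 \<le> D \<Longrightarrow> \<exists>R>0. \<forall>a\<in>I. \<exists>\<U> :: nat \<Rightarrow> 'b set set.
      (\<forall>i\<le>n. R_bounded R (\<U> i) \<and> D_disjoint D (\<U> i)) \<and> S a \<subseteq> (\<Union>i\<le>n. \<Union>(\<U> i))"
    using assms(1) unfolding asdim_le_uniformly_def eventually_at_top_linorder by blast
  \<comment> \<open>Families are available only beyond \<open>D0\<close>, while adding
    \<open>j\<close> colours consumes a factor \<open>3 ^ j\<close> of scale.\<close>
  define D where "D = max D0 (3 ^ j * r)"
  obtain R where R: "R > 0" and U: "\<And>a. a \<in> I \<Longrightarrow> \<exists>\<U> :: nat \<Rightarrow> 'b set set.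
      (\<forall>i\<le>n. R_bounded R (\<U> i) \<and> D_disjoint D (\<U> i)) \<and> S a \<subseteq> (\<Union>i\<le>n. \<Union>(\<U> i))"
    using D0[of D] by (auto simp: D_def)
  have "\<exists>A. multi_cover (S a) n (Suc n + j) r (R + 3 ^ j * r - r) A" if a: "a \<in> I" for a
  proof -
    obtain \<U> :: "nat \<Rightarrow> 'b set set" where "\<forall>i\<le>n. R_bounded R (\<U> i) \<and> D_disjoint D (\<U> i)"
      and "S a \<subseteq> (\<Union>i\<le>n. \<Union>(\<U> i))"
      using U[OF a] by blast
    then have "multi_cover (S a) n (Suc n) D R (\<lambda>i. \<Union>(\<U> i))"
      using R by (intro multi_cover_families) auto
    then have "multi_cover (S a) n (Suc n) (3 ^ j * r) R (\<lambda>i. \<Union>(\<U> i))"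
      by (rule multi_cover_mono) (auto simp: D_def)
    then show ?thesis
      using assms(2) by (rule Kolmogorov_trick)
  qed
  moreover have "1 * r \<le> 3 ^ j * r"
    using assms(2) by (intro mult_right_mono) auto
  then have "0 \<le> R + 3 ^ j * r - r"
    using R by simp
  ultimately show ?thesis by blast
qed

lemma asdim_le_families:
  assumes "asdim_le X n" "0 < D"
  obtains \<U> :: "nat \<Rightarrow> 'a::metric_space set set" and R
  where "\<And>i. i \<le> n \<Longrightarrow> \<U> i \<subseteq> Pow X" "\<And>i. i \<le> n \<Longrightarrow> R_bounded R (\<U> i)"
    "\<And>i. i \<le> n \<Longrightarrow> D_disjoint D (\<U> i)" "X \<subseteq> (\<Union>i\<le>n. \<Union>(\<U> i))" "0 < R"
proof -
  have "\<exists>\<U> :: nat \<Rightarrow> 'a set set.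
      (\<forall>i\<le>n. \<U> i \<subseteq> Pow X \<and> (\<exists>R. R_bounded R (\<U> i)) \<and> D_disjoint D (\<U> i)) \<and>
      X \<subseteq> (\<Union>i\<le>n. \<Union>(\<U> i))"
    by (rule mp[OF spec[OF assms(1)[unfolded asdim_le_def]] assms(2)])
  then obtain \<U> :: "nat \<Rightarrow> 'a set set" where U:
    "\<forall>i\<le>n. \<U> i \<subseteq> Pow X \<and> (\<exists>R. R_bounded R (\<U> i)) \<and> D_disjoint D (\<U> i)"
    "X \<subseteq> (\<Union>i\<le>n. \<Union>(\<U> i))"
    by (elim exE conjE)
  from U(1) have "\<forall>i. \<exists>R. i \<le> n \<longrightarrow> R_bounded R (\<U> i)"
    by blast
  then obtain B where B: "\<And>i. i \<le> n \<Longrightarrow> R_bounded (B i) (\<U> i)"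
    by metis
  \<comment> \<open>One bound for all families; inserting 1 makes it positive.\<close>
  define R where "R = Max (insert 1 (B ` {..n}))"
  have le: "B i \<le> R" if "i \<le> n" for i
    unfolding R_def using that by (intro Max_ge) auto
  have "1 \<le> R"
    unfolding R_def by (intro Max_ge) auto
  moreover have "R_bounded R (\<U> i)" if "i \<le> n" for i
    using B[OF that] le[OF that] unfolding R_bounded_def by force
  ultimately show ?thesis
    using U by (intro that[of \<U> R]) auto
qed

text \<open>A single space is a uniform family over a one-point index set.\<close>

lemma asdim_le_multi_cover:
  fixes X :: "'a::metric_space set"
  assumes "asdim_le X n" "0 \<le> r"
  shows "\<exists>R\<ge>0. \<exists>A. multi_cover X n (Suc n + j) r R A"
proof -
  have "asdim_le_uniformly {()} (\<lambda>_. X) n"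
    unfolding asdim_le_uniformly_def
    using eventually_gt_at_top[of 0]
  proof eventually_elim
    case (elim D)
    obtain \<U> :: "nat \<Rightarrow> 'a set set" and R where
      U: "\<And>i. i \<le> n \<Longrightarrow> \<U> i \<subseteq> Pow X" "\<And>i. i \<le> n \<Longrightarrow> R_bounded R (\<U> i)"
         "\<And>i. i \<le> n \<Longrightarrow> D_disjoint D (\<U> i)" "X \<subseteq> (\<Union>i\<le>n. \<Union>(\<U> i))" "0 < R"
      by (rule asdim_le_families[OF assms(1) elim]) (rule that)
    show ?case
      by (intro exI[of _ R] exI[of _ \<U>] conjI ballI allI impI U)
  qed
  from asdim_le_uniformly_multi_cover[OF this assms(2)] show ?thesis by simp
qed

section \<open>The Hurewicz-type theorem\<close>

lemma chain_image:
  assumes "chain r A x y" "f ` A \<subseteq> B"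
    and "\<And>u v. u \<in> A \<Longrightarrow> v \<in> A \<Longrightarrow> dist u v \<le> r \<Longrightarrow> dist (f u) (f v) \<le> s"
  shows "chain s B (f x) (f y)"
  using assms(1)
  by (induction rule: chain_induct) (use assms(2,3) in \<open>auto intro: chain_step\<close>)

lemma asdim_le_Hurewicz:
  fixes f :: "'a::metric_space \<Rightarrow> 'b::metric_space"
  assumes fXY: "f \<in> X \<rightarrow> Y" and lip: "L-lipschitz_on X f"
    and fib: "\<And>R. R > 0 \<Longrightarrow> asdim_le_uniformly Y (\<lambda>y. X \<inter> f -` ball y R) n"
    and Y: "asdim_le Y m"
  shows "asdim_le X (m + n)"
  unfolding asdim_le_def
proof (intro allI impI)
  fix D :: real assume "D > 0"
  \<comment> \<open>Strictly above \<open>D\<close>, as required for splitting into components at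
    the end.\<close>
  define r where "r = D + 1"
  have r: "0 \<le> r" "D < r" using \<open>D > 0\<close> by (auto simp: r_def)
  have L: "0 \<le> L" using lip by (rule lipschitz_on_nonneg)
  \<comment> \<open>The same number of colours arises on \<open>Y\<close> from \<open>m + 1\<close>
    by adding \<open>n\<close>, and on the preimages from \<open>n + 1\<close> by adding
    \<open>m\<close>.\<close>
  define k where "k = Suc (m + n)"
  obtain S C where "S \<ge> 0" and C: "multi_cover Y m k (L * r) S C"
    using asdim_le_multi_cover[OF Y, of "L * r" n] r L by (auto simp: k_def)
  \<comment> \<open>Sets more than \<open>S\<close> apart cannot both meet a set of diameter at most
    \<open>S\<close>; the summand 1 keeps the scale positive when \<open>S = 0\<close>.\<close>
  obtain \<Z> :: "nat \<Rightarrow> 'b set set" and T where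
    Z: "\<And>l. l \<le> m \<Longrightarrow> \<Z> l \<subseteq> Pow Y" "\<And>l. l \<le> m \<Longrightarrow> R_bounded T (\<Z> l)"
       "\<And>l. l \<le> m \<Longrightarrow> D_disjoint (S + 1) (\<Z> l)" "Y \<subseteq> (\<Union>l\<le>m. \<Union>(\<Z> l))" and "0 < T"
    using asdim_le_families[OF Y, of "S + 1"] \<open>S \<ge> 0\<close> by (metis add_nonneg_pos zero_less_one)
  \<comment> \<open>Balls are open, so radius \<open>T + 1\<close> ensures that a set of diameter at
    most \<open>T\<close> lies in the ball about any of its points.\<close>
  let ?F = "\<lambda>y. X \<inter> f -` ball y (T + 1)"
  have "\<exists>R. 0 \<le> R \<and> (\<forall>y\<in>Y. \<exists>A. multi_cover (?F y) n k s R A)" if "0 \<le> s" for s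
    using asdim_le_uniformly_multi_cover[OF fib that, of "T + 1" m] \<open>0 < T\<close>
    by (auto simp: k_def add_ac)
  then obtain \<rho> where \<rho>: "\<And>s. 0 \<le> s \<Longrightarrow> 0 \<le> \<rho> s"
    and \<rho>_cov: "\<And>s. 0 \<le> s \<Longrightarrow> \<forall>y\<in>Y. \<exists>A. multi_cover (?F y) n k s (\<rho> s) A"
    by metis
  let ?s = "glued_scale \<rho> r"
  have s_nonneg: "0 \<le> ?s l" for l
    using \<rho> r(1) by (rule glued_scale_nonneg)
  have "\<forall>l. \<forall>y\<in>Y. \<exists>A. multi_cover (?F y) n k (?s l) (\<rho> (?s l)) A"
    using \<rho>_cov[OF s_nonneg] by blast
  then obtain A where A: "\<And>l y. y \<in> Y \<Longrightarrow> multi_cover (?F y) n k (?s l) (\<rho> (?s l)) (A l y)"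
    by metis
  \<comment> \<open>A centre for each member \<open>V\<close>: the preimage of \<open>V\<close> in
    \<open>X\<close> is then coloured through the ball about \<open>c V\<close>.\<close>
  define c where "c V = (SOME y. y \<in> V)" for V :: "'b set"
  have c: "c V \<in> V" if "y \<in> V" for y V
    unfolding c_def using that by (rule someI)
  define W where "W l i = {x. \<exists>V\<in>\<Z> l. f x \<in> V \<and> x \<in> A l (c V) i}" for l i
  define E where "E i = {x\<in>X. f x \<in> C i \<and> (\<exists>l\<le>m. x \<in> W l i)}" for i
  have E_bounded: "scale_bounded r (glued_bound \<rho> r m) (E i)" if i: "i < k" for i
    unfolding scale_bounded_def
  proof (intro allI impI)
    fix x y assume xy: "chain r (E i) x y"
    \<comment> \<open>The part of the component of \<open>x\<close> that is handled by the
      \<open>l\<close>-th family.\<close>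
    define G where "G l = {w. chain r (E i) x w \<and> w \<in> W l i}" for l
    have fS: "dist (f u) (f v) \<le> S" if "chain r (E i) u v" for u v
    proof -
      have "chain (L * r) (C i) (f u) (f v)"
        using that
      proof (rule chain_image)
        fix u v assume uv: "u \<in> E i" "v \<in> E i" "dist u v \<le> r"
        then have "dist (f u) (f v) \<le> L * dist u v"
          using lip by (intro lipschitz_onD) (auto simp: E_def)
        also have "\<dots> \<le> L * r"
          using uv L by (intro mult_left_mono) auto
        finally show "dist (f u) (f v) \<le> L * r" .
      qed (auto simp: E_def)
      then show ?thesis
        using C i by (auto simp: multi_cover_def dest: scale_boundedD)
    qed
    have "scale_bounded (?s l) (\<rho> (?s l)) (G l)" if l: "l \<le> m" for l
    proof (cases "G l = {}")
      case True
      have "chain a {} u v \<Longrightarrow> u = v" for a and u v :: 'a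
        by (induction rule: chain_induct) auto
      then show ?thesis
        using True \<rho>[OF s_nonneg] by (fastforce simp: scale_bounded_def)
    next
      case False
      then obtain u V where u: "chain r (E i) x u" and V: "V \<in> \<Z> l" "f u \<in> V"
        by (auto simp: G_def W_def)
      \<comment> \<open>Images of points of one component are within \<open>S\<close> of each other,
        so they meet only one member of \<open>\<Z> l\<close>, and a single colouring governs all of
        \<open>G l\<close>.\<close>
      have "G l \<subseteq> A l (c V) i"
      proof
        fix w assume "w \<in> G l"
        then obtain V' where w: "chain r (E i) x w" and V': "V' \<in> \<Z> l" "f w \<in> V'"
          and wA: "w \<in> A l (c V') i"
          by (auto simp: G_def W_def)
        have "dist (f u) (f w) \<le> S"
          using u w chain_sym chain_trans by (metis fS)
        then have "setdist V V' \<le> S"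
          using setdist_le_dist[OF V(2) V'(2)] by linarith
        then have "V = V'"
          using Z(3)[OF l] V V' unfolding D_disjoint_def by fastforce
        then show "w \<in> A l (c V) i" using wA by simp
      qed
      moreover have "c V \<in> Y"
        using c[OF V(2)] Z(1)[OF l] V(1) by auto
      then have "scale_bounded (?s l) (\<rho> (?s l)) (A l (c V) i)"
        using A i by (auto simp: multi_cover_def)
      ultimately show ?thesis
        using scale_bounded_mono by blast
    qed
    then have "scale_bounded r (glued_bound \<rho> r m) (\<Union>l\<le>m. G l)"
      using r(1) by (rule scale_bounded_UN)
    \<comment> \<open>Every point of \<open>E i\<close> reached from \<open>x\<close> lies in some
      \<open>G l\<close>, so the chain already runs in the glued union.\<close>
    moreover have "chain r (\<Union>l\<le>m. G l) x y"
      using xy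
    proof (induction rule: chain_induct)
      case refl
      show ?case by simp
    next
      case (step y z)
      moreover have "chain r (E i) x z"
        using step.hyps by (auto intro: chain_step)
      ultimately have "y \<in> (\<Union>l\<le>m. G l)" "z \<in> (\<Union>l\<le>m. G l)"
        by (auto simp: G_def E_def)
      then show ?case
        using step.IH step.hyps chain_step by blast
    qed
    ultimately show "dist x y \<le> glued_bound \<rho> r m"
      by (rule scale_boundedD)
  qed
  have E_cover: "\<exists>i<k. x \<in> E i" if x: "x \<in> X" for x
  proof -
    have fx: "f x \<in> Y" using x fXY by auto
    then obtain l V where l: "l \<le> m" and V: "V \<in> \<Z> l" "f x \<in> V"
      using Z(4) by auto
    have cV: "c V \<in> V" using c[OF V(2)] .
    then have cY: "c V \<in> Y" using Z(1)[OF l] V(1) by auto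
    have "dist (c V) (f x) \<le> diameter V"
      using Z(2)[OF l] V cV by (intro diameter_bounded_bound) (auto simp: R_bounded_def)
    also have "\<dots> \<le> T"
      using Z(2)[OF l] V by (auto simp: R_bounded_def)
    finally have "x \<in> ?F (c V)" using x by simp
    then have 1: "k \<le> n + card {i. i < k \<and> x \<in> A l (c V) i}" (is "_ \<le> _ + card ?P")
      using A[OF cY, of l] unfolding multi_cover_def by blast
    have 2: "k \<le> m + card {i. i < k \<and> f x \<in> C i}" (is "_ \<le> _ + card ?Q")
      using C fx unfolding multi_cover_def by blast
    have "card (?P \<union> ?Q) \<le> card {..<k}"
      by (rule card_mono) auto
    \<comment> \<open>Pigeonhole: \<open>?P\<close> has at least \<open>m + 1\<close> colours and
      \<open>?Q\<close> at least \<open>n + 1\<close>, together more than \<open>k\<close>.\<close>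
    then have "?P \<inter> ?Q \<noteq> {}"
      using 1 2 card_Un_disjoint[of ?P ?Q] by (auto simp: k_def)
    then obtain i where "i < k" "x \<in> A l (c V) i" "f x \<in> C i" by auto
    then have "x \<in> E i"
      using x l V by (auto simp: E_def W_def)
    then show ?thesis using \<open>i < k\<close> by blast
  qed
  have "\<exists>\<U>. \<U> \<subseteq> Pow (E i) \<and> R_bounded (glued_bound \<rho> r m) \<U> \<and> D_disjoint D \<U> \<and> \<Union>\<U> = E i"
    if "i < k" for i
    using scale_bounded_components[OF E_bounded[OF that] r(2)] by metis
  then obtain \<U> where "\<And>i. i < k \<Longrightarrow> \<U> i \<subseteq> Pow (E i) \<and>
      R_bounded (glued_bound \<rho> r m) (\<U> i) \<and> D_disjoint D (\<U> i) \<and> \<Union>(\<U> i) = E i"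
    by metis
  then have U: "\<U> i \<subseteq> Pow (E i)" "R_bounded (glued_bound \<rho> r m) (\<U> i)" "D_disjoint D (\<U> i)"
      "\<Union>(\<U> i) = E i" if "i < k" for i
    using that by simp_all
  show "\<exists>\<U> :: nat \<Rightarrow> 'a set set.
        (\<forall>i\<le>m + n. \<U> i \<subseteq> Pow X \<and> (\<exists>R. R_bounded R (\<U> i)) \<and> D_disjoint D (\<U> i)) \<and>
        X \<subseteq> (\<Union>i\<le>m + n. \<Union>(\<U> i))"
  proof (intro exI[of _ \<U>] conjI allI impI)
    fix i assume "i \<le> m + n"
    then have i: "i < k" by (simp add: k_def)
    show "\<U> i \<subseteq> Pow X" using U(1)[OF i] by (auto simp: E_def)
    show "\<exists>R. R_bounded R (\<U> i)" using U(2)[OF i] ..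
    show "D_disjoint D (\<U> i)" using U(3)[OF i] .
  next
    show "X \<subseteq> (\<Union>i\<le>m + n. \<Union>(\<U> i))"
    proof
      fix x assume "x \<in> X"
      then obtain i where "i < k" "x \<in> E i" using E_cover by blast
      then have "i \<le> m + n" "x \<in> \<Union>(\<U> i)" using U(4)[of i] by (auto simp: k_def)
      then show "x \<in> (\<Union>i\<le>m + n. \<Union>(\<U> i))" by blast
    qed
  qed
qed

text \<open>A finite infimum in \<open>enat\<close> comes from a nonempty set and, by well-ordering,
  is attained.\<close>

lemma asdim_le_asdim:
  assumes "asdim Y = enat m"
  shows "asdim_le Y m"
proof -
  have "{enat n | n. asdim_le Y n} \<noteq> {}"
    using assms unfolding asdim_def Inf_enat_def by (auto split: if_splits)
  then have "asdim Y \<in> {enat n | n. asdim_le Y n}"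
    unfolding asdim_def by (metis (no_types, lifting) Inf_enat_def LeastI ex_in_conv)
  then show ?thesis using assms by simp
qed

theorem theorem1:
  fixes f :: "'a::metric_space \<Rightarrow> 'b::metric_space"
    and X :: "'a set" and Y :: "'b set" and n :: nat
  assumes "geodesic_space X"
    and "f \<in> X \<rightarrow> Y"
    and "\<exists>L. L-lipschitz_on X f"
    and "\<And>R. R > 0 \<Longrightarrow> asdim_le_uniformly Y (\<lambda>y. X \<inter> f -` ball y R) n"
  shows "asdim X \<le> asdim Y + enat n"
proof (cases "asdim Y")
  \<comment> \<open>Only finite \<open>asdim Y\<close> needs an argument; otherwise the right-hand
    side is infinite.\<close>
  case (enat m)
  then have "asdim_le X (m + n)"
    using assms asdim_le_asdim asdim_le_Hurewicz by blast
  then have "asdim X \<le> enat (m + n)"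
    unfolding asdim_def by (intro Inf_lower) auto
  then show ?thesis using enat by simp
qed simp

end
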